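(* Let $\mathcal A$ be a subvariety of the variety of residuated lattices which is $\diamond$-closed, i.e. $A^\diamond\in\mathcal A$ for every $A\in\mathcal A$. Then every absolute retract in $\mathcal A$ is trivial (has exactly one element).
   Context: A residuated lattice is an algebra $\langle A,\wedge,\vee,\odot,\rightarrow,0,1\rangle$ of type $\langle 2,2,2,2,0,0\rangle$ such that $\langle A,\odot,1\rangle$ is a commutative monoid, $\langle A,\vee,\wedge,0,1\rangle$ is a bounded lattice (with order $\le$), and for all $a,b,c$: $a\odot b\le c$ iff $a\le b\rightarrow c$. Homomorphisms preserve all operations including $0,1$. For a residuated lattice $A$, $A^\diamond$ is the set $\{(a,b)\in A\times A : a\le b\}$ with operations $(a_1,b_1)\wedge(a_2,b_2)=(a_1\wedge a_2,b_1\wedge b_2)$, $(a_1,b_1)\vee(a_2,b_2)=(a_1\vee a_2,b_1\vee b_2)$, $(a_1,b_1)\odot(a_2,b_2)=(a_1\odot a_2,(a_1\odot b_2)\vee(a_2\odot b_1))$, $(a_1,b_1)\rightarrow(a_2,b_2)=((a_1\rightarrow a_2)\wedge(b_1\rightarrow b_2), a_1\rightarrow b_2)$, and constants $(0,0)$ and $(1,1)$; this is a residuated lattice. An algebra $A\in\mathcal A$ is an absolute retract in $\mathcal A$ if for every $B\in\mathcal A$ and every injective homomorphism $i:A\to B$ there is a homomorphism $r:B\to A$ with $r\circ i=1_A$. *)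

theory Defs
  imports "HOL-Algebra.Group"
begin

text \<open>Algebras of the signature of residuated lattices. The components \<open>carrier\<close>,
  \<open>mult\<close> (written \<open>\<otimes>\<close>) and \<open>one\<close> (written \<open>\<one>\<close>) come from the HOL-Algebra record of monoids.\<close>

record 'a rlat = "'a monoid" +
  rmeet :: "'a \<Rightarrow> 'a \<Rightarrow> 'a" (infixl \<open>\<curlywedge>\<index>\<close> 65)
  rjoin :: "'a \<Rightarrow> 'a \<Rightarrow> 'a" (infixl \<open>\<curlyvee>\<index>\<close> 65)
  rimp :: "'a \<Rightarrow> 'a \<Rightarrow> 'a" (infixr \<open>\<leadsto>\<index>\<close> 60)
  rzero :: "'a" (\<open>\<zero>\<index>\<close>)

definition rle :: "('a, 'm) rlat_scheme \<Rightarrow> 'a \<Rightarrow> 'a \<Rightarrow> bool" (infixl \<open>\<preceq>\<index>\<close> 50)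
  where "a \<preceq>\<^bsub>A\<^esub> b \<longleftrightarrow> a \<curlywedge>\<^bsub>A\<^esub> b = a"

locale residuated_lattice = comm_monoid A for A (structure) +
  assumes meet_closed: "\<lbrakk>a \<in> carrier A; b \<in> carrier A\<rbrakk> \<Longrightarrow> a \<curlywedge> b \<in> carrier A"
    and join_closed: "\<lbrakk>a \<in> carrier A; b \<in> carrier A\<rbrakk> \<Longrightarrow> a \<curlyvee> b \<in> carrier A"
    and imp_closed: "\<lbrakk>a \<in> carrier A; b \<in> carrier A\<rbrakk> \<Longrightarrow> (a \<leadsto> b) \<in> carrier A"
    and zero_closed: "\<zero> \<in> carrier A"
    and meet_comm: "\<lbrakk>a \<in> carrier A; b \<in> carrier A\<rbrakk> \<Longrightarrow> a \<curlywedge> b = b \<curlywedge> a"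
    and join_comm: "\<lbrakk>a \<in> carrier A; b \<in> carrier A\<rbrakk> \<Longrightarrow> a \<curlyvee> b = b \<curlyvee> a"
    and meet_assoc: "\<lbrakk>a \<in> carrier A; b \<in> carrier A; c \<in> carrier A\<rbrakk>
      \<Longrightarrow> (a \<curlywedge> b) \<curlywedge> c = a \<curlywedge> (b \<curlywedge> c)"
    and join_assoc: "\<lbrakk>a \<in> carrier A; b \<in> carrier A; c \<in> carrier A\<rbrakk>
      \<Longrightarrow> (a \<curlyvee> b) \<curlyvee> c = a \<curlyvee> (b \<curlyvee> c)"
    and meet_join_absorb: "\<lbrakk>a \<in> carrier A; b \<in> carrier A\<rbrakk> \<Longrightarrow> a \<curlywedge> (a \<curlyvee> b) = a"
    and join_meet_absorb: "\<lbrakk>a \<in> carrier A; b \<in> carrier A\<rbrakk> \<Longrightarrow> a \<curlyvee> (a \<curlywedge> b) = a"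
    and zero_least: "a \<in> carrier A \<Longrightarrow> \<zero> \<preceq> a"
    and one_greatest: "a \<in> carrier A \<Longrightarrow> a \<preceq> \<one>"
    and residuation: "\<lbrakk>a \<in> carrier A; b \<in> carrier A; c \<in> carrier A\<rbrakk>
      \<Longrightarrow> a \<otimes> b \<preceq> c \<longleftrightarrow> a \<preceq> (b \<leadsto> c)"

definition rlat_hom :: "('a, 'm) rlat_scheme \<Rightarrow> ('b, 'n) rlat_scheme \<Rightarrow> ('a \<Rightarrow> 'b) set"
  where "rlat_hom A B = {h \<in> hom A B.
    (\<forall>a\<in>carrier A. \<forall>b\<in>carrier A. h (a \<curlywedge>\<^bsub>A\<^esub> b) = h a \<curlywedge>\<^bsub>B\<^esub> h b) \<and>
    (\<forall>a\<in>carrier A. \<forall>b\<in>carrier A. h (a \<curlyvee>\<^bsub>A\<^esub> b) = h a \<curlyvee>\<^bsub>B\<^esub> h b) \<and>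
    (\<forall>a\<in>carrier A. \<forall>b\<in>carrier A. h (a \<leadsto>\<^bsub>A\<^esub> b) = (h a \<leadsto>\<^bsub>B\<^esub> h b)) \<and>
    h \<zero>\<^bsub>A\<^esub> = \<zero>\<^bsub>B\<^esub> \<and> h \<one>\<^bsub>A\<^esub> = \<one>\<^bsub>B\<^esub>}"

definition diamond :: "'a rlat \<Rightarrow> ('a \<times> 'a) rlat"
  where "diamond A = \<lparr>
    carrier = {(a, b). a \<in> carrier A \<and> b \<in> carrier A \<and> a \<preceq>\<^bsub>A\<^esub> b},
    mult = (\<lambda>(a1, b1) (a2, b2). (a1 \<otimes>\<^bsub>A\<^esub> a2, (a1 \<otimes>\<^bsub>A\<^esub> b2) \<curlyvee>\<^bsub>A\<^esub> (a2 \<otimes>\<^bsub>A\<^esub> b1))),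
    one = (\<one>\<^bsub>A\<^esub>, \<one>\<^bsub>A\<^esub>),
    rmeet = (\<lambda>(a1, b1) (a2, b2). (a1 \<curlywedge>\<^bsub>A\<^esub> a2, b1 \<curlywedge>\<^bsub>A\<^esub> b2)),
    rjoin = (\<lambda>(a1, b1) (a2, b2). (a1 \<curlyvee>\<^bsub>A\<^esub> a2, b1 \<curlyvee>\<^bsub>A\<^esub> b2)),
    rimp = (\<lambda>(a1, b1) (a2, b2). ((a1 \<leadsto>\<^bsub>A\<^esub> a2) \<curlywedge>\<^bsub>A\<^esub> (b1 \<leadsto>\<^bsub>A\<^esub> b2), a1 \<leadsto>\<^bsub>A\<^esub> b2)),
    rzero = (\<zero>\<^bsub>A\<^esub>, \<zero>\<^bsub>A\<^esub>)\<rparr>"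

datatype rterm =
    Var nat
  | Meet rterm rterm
  | Join rterm rterm
  | Times rterm rterm
  | Imp rterm rterm
  | Zero
  | One

primrec reval :: "('a, 'm) rlat_scheme \<Rightarrow> (nat \<Rightarrow> 'a) \<Rightarrow> rterm \<Rightarrow> 'a"
  where
    "reval A v (Var n) = v n"
  | "reval A v (Meet s t) = reval A v s \<curlywedge>\<^bsub>A\<^esub> reval A v t"
  | "reval A v (Join s t) = reval A v s \<curlyvee>\<^bsub>A\<^esub> reval A v t"
  | "reval A v (Times s t) = reval A v s \<otimes>\<^bsub>A\<^esub> reval A v t"
  | "reval A v (Imp s t) = (reval A v s \<leadsto>\<^bsub>A\<^esub> reval A v t)"
  | "reval A v Zero = \<zero>\<^bsub>A\<^esub>"
  | "reval A v One = \<one>\<^bsub>A\<^esub>"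

text \<open>A subvariety of residuated lattices is given by a set \<open>E\<close> of identities. Membership
  makes sense for algebras over every type, so that \<open>A\<close> and \<open>diamond A\<close> can be compared with
  the same subvariety. Conversely \<open>subvariety E\<close> at type \<open>'a\<close> collects
  the members whose carrier is a subset of \<open>'a\<close>.\<close>

definition subvariety :: "(rterm \<times> rterm) set \<Rightarrow> 'a rlat set"
  where "subvariety E = {A. residuated_lattice A \<and>
    (\<forall>(s, t)\<in>E. \<forall>v. range v \<subseteq> carrier A \<longrightarrow> reval A v s = reval A v t)}"

text \<open>HOL cannot quantify over types inside a formula. The next two definitions therefore
  range over the algebras whose carriers are subsets of one type \<open>'u\<close>, which plays the role of
  a universe; it is assumed to be infinite where they are used. Carriers are sets, so algebras
  of every smaller cardinality occur as well. For infinite \<open>'u\<close>, closure under \<open>diamond\<close> over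
  \<open>'u\<close> is the same as closure over all types: an identity that fails in \<open>diamond A\<close> already
  fails in \<open>diamond C\<close> for a countable subalgebra \<open>C\<close> of \<open>A\<close>.\<close>

definition diamond_closed :: "'u itself \<Rightarrow> (rterm \<times> rterm) set \<Rightarrow> bool"
  where "diamond_closed _ E \<longleftrightarrow>
    (\<forall>A :: 'u rlat. A \<in> subvariety E \<longrightarrow> diamond A \<in> subvariety E)"

definition absolute_retract :: "(rterm \<times> rterm) set \<Rightarrow> 'u rlat \<Rightarrow> bool"
  where "absolute_retract E A \<longleftrightarrow> A \<in> subvariety E \<and>
    (\<forall>B :: 'u rlat. B \<in> subvariety E \<longrightarrow>
      (\<forall>i \<in> rlat_hom A B. inj_on i (carrier A) \<longrightarrow>
        (\<exists>r \<in> rlat_hom B A. \<forall>x\<in>carrier A. r (i x) = x)))"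

end

theory Submission
  imports Defs
begin

text \<open>The diagonal \<open>a \<mapsto> (a, a)\<close> embeds \<open>A\<close> into \<open>diamond A\<close>, so an absolute retract \<open>A\<close> has a
  retraction \<open>r\<close> of it. The element \<open>(0, 1)\<close> is its own negation, hence so is \<open>c = r (0, 1)\<close>, and
  \<open>c \<odot> c = 0\<close>. Now \<open>(0, c) = (c, c) \<and> (0, 1)\<close> is sent to \<open>c\<close>, while
  \<open>(0, c) = ((c, c) \<or> (0, 1)) \<odot> (c, c)\<close> is sent to \<open>c \<odot> c = 0\<close>. Thus \<open>c = 0\<close> and
  \<open>0 = \<not>0 = 1\<close>. Since \<open>diamond A\<close> lives over pairs, it is first copied back to the universe
  along a bijection with its square.\<close>

context residuated_lattice
begin

text \<open>Absorption twice: \<open>a \<curlywedge> a = a \<curlywedge> (a \<curlyvee> (a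
  \<curlywedge> a)) = a\<close>.\<close>

lemma meet_idem:
  assumes "a \<in> carrier A"
  shows "a \<curlywedge> a = a"
  by (metis assms meet_closed join_meet_absorb meet_join_absorb)

lemma join_idem:
  assumes "a \<in> carrier A"
  shows "a \<curlyvee> a = a"
  by (metis assms join_meet_absorb meet_idem)

lemma rle_refl:
  assumes "a \<in> carrier A"
  shows "a \<preceq> a"
  using assms by (simp add: rle_def meet_idem)

lemma rle_antisym:
  assumes "a \<in> carrier A" "b \<in> carrier A" "a \<preceq> b" "b \<preceq> a"
  shows "a = b"
  using assms by (metis rle_def meet_comm)

lemma join_eq_if_rle:
  assumes "a \<in> carrier A" "b \<in> carrier A" "a \<preceq> b"
  shows "a \<curlyvee> b = b"
  using assms by (metis rle_def meet_comm join_comm join_meet_absorb)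

lemma zero_imp_zero: "\<zero> \<leadsto> \<zero> = \<one>"
proof -
  have "\<one> \<otimes> \<zero> \<preceq> \<zero>"
    by (simp add: zero_closed rle_refl)
  then have "\<one> \<preceq> (\<zero> \<leadsto> \<zero>)"
    using residuation[of \<one> \<zero> \<zero>] by (simp add: zero_closed)
  then show ?thesis
    by (simp add: rle_antisym one_greatest imp_closed zero_closed)
qed

lemma one_imp_zero: "\<one> \<leadsto> \<zero> = \<zero>"
proof -
  \<comment> \<open>Residuation turns this into reflexivity at
    \<open>\<one> \<leadsto> \<zero>\<close>; the factor \<open>\<one>\<close> is cancelled only
    afterwards.\<close>
  have "(\<one> \<leadsto> \<zero>) \<otimes> \<one> \<preceq> \<zero>"
    using residuation[of "\<one> \<leadsto> \<zero>" \<one> \<zero>]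
    by (simp del: r_one add: imp_closed zero_closed rle_refl)
  then show ?thesis
    by (simp add: rle_antisym zero_least imp_closed zero_closed)
qed

lemma carrier_eq_singleton_if_zero_eq_one:
  assumes "\<zero> = \<one>"
  shows "carrier A = {\<zero>}"
proof -
  have "a = \<zero>" if "a \<in> carrier A" for a
    using that assms zero_least[OF that] one_greatest[OF that]
    by (simp add: rle_antisym zero_closed)
  then show ?thesis
    using zero_closed by blast
qed

end

lemma diagonal_in_rlat_hom:
  fixes A :: "'a rlat" (structure)
  assumes "residuated_lattice A"
  shows "(\<lambda>a. (a, a)) \<in> rlat_hom A (diamond A)"
proof -
  interpret residuated_lattice A by fact
  \<comment> \<open>The right-hand side is the second component of the product of
    \<open>(a, a)\<close> and \<open>(b, b)\<close> in \<open>diamond A\<close>.\<close>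
  have "a \<otimes> b = a \<otimes> b \<curlyvee> b \<otimes> a" if "a \<in> carrier A" "b \<in> carrier A" for a b
    using that by (simp add: m_comm join_idem)
  then show ?thesis
    by (auto simp: rlat_hom_def hom_def diamond_def rle_refl meet_idem imp_closed)
qed

lemma zero_eq_one_if_diamond_retract:
  fixes A :: "'a rlat" (structure)
  assumes "residuated_lattice A"
    and r: "r \<in> rlat_hom (diamond A) A"
    and retract: "\<And>a. a \<in> carrier A \<Longrightarrow> r (a, a) = a"
  shows "\<zero> = \<one>"
proof -
  interpret residuated_lattice A by fact
  let ?D = "diamond A"
  define c where "c = r (\<zero>, \<one>)"
  have e: "(\<zero>, \<one>) \<in> carrier ?D"
    by (simp add: diamond_def zero_closed zero_least)
  have diag: "(a, a) \<in> carrier ?D" if "a \<in> carrier A" for a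
    using that by (simp add: diamond_def rle_refl)
  have c: "c \<in> carrier A"
    using r e by (auto simp: c_def rlat_hom_def hom_def)
  \<comment> \<open>The components are \<open>(\<zero> \<leadsto> \<zero>) \<curlywedge> (\<one>
    \<leadsto> \<zero>) = \<one> \<curlywedge> \<zero>\<close> and
    \<open>\<zero> \<leadsto> \<zero> = \<one>\<close>.\<close>
  have e_neg: "((\<zero>, \<one>) \<leadsto>\<^bsub>?D\<^esub> (\<zero>, \<zero>)) = (\<zero>, \<one>)"
    using one_greatest[OF zero_closed] zero_least[OF one_closed]
    by (simp add: diamond_def zero_imp_zero one_imp_zero rle_def meet_comm zero_closed)
  have "r ((\<zero>, \<one>) \<leadsto>\<^bsub>?D\<^esub> (\<zero>, \<zero>)) = (r (\<zero>, \<one>) \<leadsto> r (\<zero>, \<zero>))"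
    using r e diag[OF zero_closed] by (simp add: rlat_hom_def)
  then have c_neg: "(c \<leadsto> \<zero>) = c"
    by (simp add: e_neg c_def retract zero_closed)
  \<comment> \<open>Residuation applied to \<open>c \<preceq> (c \<leadsto> \<zero>)\<close>, one
    half of self-negation.\<close>
  then have "c \<otimes> c \<preceq> \<zero>"
    using c by (simp add: residuation zero_closed rle_refl)
  then have cc: "c \<otimes> c = \<zero>"
    using c by (simp add: rle_antisym zero_least zero_closed)
  have cz: "c \<curlywedge> \<zero> = \<zero>" "\<zero> \<curlyvee> c = c" "c \<curlyvee> \<zero> = c"
    using c zero_least[OF c] join_eq_if_rle[OF zero_closed c]
    by (simp_all add: rle_def meet_comm join_comm zero_closed)
  have c1: "c \<curlywedge> \<one> = c" "c \<curlyvee> \<one> = \<one>"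
    using c one_greatest[OF c] join_eq_if_rle[OF c one_closed] by (simp_all add: rle_def)
  have meet: "(c, c) \<curlywedge>\<^bsub>?D\<^esub> (\<zero>, \<one>) = (\<zero>, c)"
    by (simp add: diamond_def cz c1)
  have join: "(c, c) \<curlyvee>\<^bsub>?D\<^esub> (\<zero>, \<one>) = (c, \<one>)"
    by (simp add: diamond_def cz c1)
  \<comment> \<open>The second component is \<open>(c \<otimes> c) \<curlyvee> (c \<otimes> \<one>)
    = \<zero> \<curlyvee> c\<close>, so \<open>c\<close> survives there although the first component
    vanishes.\<close>
  have mult: "(c, \<one>) \<otimes>\<^bsub>?D\<^esub> (c, c) = (\<zero>, c)"
    using c by (simp add: diamond_def cc cz)
  have "r ((c, c) \<curlywedge>\<^bsub>?D\<^esub> (\<zero>, \<one>)) = c \<curlywedge> c"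
    using r e diag[OF c] c by (simp add: rlat_hom_def c_def[symmetric] retract)
  then have r_meet: "r (\<zero>, c) = c"
    using c by (simp add: meet meet_idem)
  have "r ((c, c) \<curlyvee>\<^bsub>?D\<^esub> (\<zero>, \<one>)) = c \<curlyvee> c"
    using r e diag[OF c] c by (simp add: rlat_hom_def c_def[symmetric] retract)
  then have r_join: "r (c, \<one>) = c"
    using c by (simp add: join join_idem)
  have "(c, \<one>) \<in> carrier ?D"
    using c by (simp add: diamond_def one_greatest)
  then have "r ((c, \<one>) \<otimes>\<^bsub>?D\<^esub> (c, c)) = c \<otimes> c"
    using r diag[OF c] c by (simp add: rlat_hom_def hom_def r_join retract)
  then have "c = \<zero>"
    by (simp add: mult r_meet cc)
  \<comment> \<open>Now \<open>c_neg\<close> reads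
    \<open>(\<zero> \<leadsto> \<zero>) = \<zero>\<close>, while the left side is
    \<open>\<one>\<close>.\<close>
  then show ?thesis
    using c_neg by (simp add: zero_imp_zero)
qed

text \<open>The inverse is taken on \<open>carrier B\<close> only, so injectivity there suffices;
  off the image of the carrier the operations have unspecified values.\<close>

definition transport :: "('a \<Rightarrow> 'b) \<Rightarrow> 'a rlat \<Rightarrow> 'b rlat"
  where "transport f B = (let g = inv_into (carrier B) f in \<lparr>
    carrier = f ` carrier B,
    mult = (\<lambda>x y. f (g x \<otimes>\<^bsub>B\<^esub> g y)),
    one = f \<one>\<^bsub>B\<^esub>,
    rmeet = (\<lambda>x y. f (g x \<curlywedge>\<^bsub>B\<^esub> g y)),
    rjoin = (\<lambda>x y. f (g x \<curlyvee>\<^bsub>B\<^esub> g y)),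
    rimp = (\<lambda>x y. f (g x \<leadsto>\<^bsub>B\<^esub> g y)),
    rzero = f \<zero>\<^bsub>B\<^esub>\<rparr>)"

locale rlat_transport = residuated_lattice B for B :: "'a rlat" (structure) +
  fixes f :: "'a \<Rightarrow> 'b"
  assumes inj: "inj_on f (carrier B)"
begin

lemma transport_simps:
  "carrier (transport f B) = f ` carrier B"
  "\<one>\<^bsub>transport f B\<^esub> = f \<one>"
  "\<zero>\<^bsub>transport f B\<^esub> = f \<zero>"
  "\<lbrakk>a \<in> carrier B; b \<in> carrier B\<rbrakk> \<Longrightarrow> f a \<otimes>\<^bsub>transport f B\<^esub> f b = f (a \<otimes> b)"
  "\<lbrakk>a \<in> carrier B; b \<in> carrier B\<rbrakk> \<Longrightarrow> f a \<curlywedge>\<^bsub>transport f B\<^esub> f b = f (a \<curlywedge> b)"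
  "\<lbrakk>a \<in> carrier B; b \<in> carrier B\<rbrakk> \<Longrightarrow> f a \<curlyvee>\<^bsub>transport f B\<^esub> f b = f (a \<curlyvee> b)"
  "\<lbrakk>a \<in> carrier B; b \<in> carrier B\<rbrakk> \<Longrightarrow> (f a \<leadsto>\<^bsub>transport f B\<^esub> f b) = f (a \<leadsto> b)"
  using inj by (simp_all add: transport_def Let_def)

lemma transport_rle:
  assumes "a \<in> carrier B" "b \<in> carrier B"
  shows "f a \<preceq>\<^bsub>transport f B\<^esub> f b \<longleftrightarrow> a \<preceq> b"
  using assms inj by (simp add: rle_def transport_simps meet_closed inj_on_eq_iff)

lemma residuated_lattice_transport: "residuated_lattice (transport f B)"
  \<comment> \<open>With the carrier written as an image, \<open>safe\<close> turns each element
    into some \<open>f a\<close>, and every axiom becomes the same axiom of \<open>B\<close> under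
    \<open>f\<close>.\<close>
  by (unfold_locales; (unfold transport_simps(1))?; safe?;
    (simp add: transport_simps(2-) transport_rle m_assoc meet_closed join_closed imp_closed
      zero_closed meet_assoc join_assoc meet_join_absorb join_meet_absorb zero_least
      one_greatest residuation)?;
    (simp add: m_comm meet_comm join_comm)?)

lemma transport_in_rlat_hom: "f \<in> rlat_hom B (transport f B)"
  by (simp add: rlat_hom_def hom_def transport_simps)

text \<open>Membership is part of the induction because the equations for the copied operations need
  arguments in \<open>carrier B\<close>.\<close>

lemma reval_transport:
  assumes "range v \<subseteq> carrier B"
  shows "reval B v t \<in> carrier B \<and> reval (transport f B) (f \<circ> v) t = f (reval B v t)"
  using assms
  by (induction t)
    (auto simp: transport_simps meet_closed join_closed imp_closed zero_closed)

lemma transport_in_subvariety: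
  assumes "B \<in> subvariety E"
  shows "transport f B \<in> subvariety E"
proof -
  have "reval (transport f B) w s = reval (transport f B) w t"
    if st: "(s, t) \<in> E" and w: "range w \<subseteq> carrier (transport f B)" for s t w
  proof -
    \<comment> \<open>Every valuation in the copy is the image of one in \<open>B\<close>, where the
      identity is known.\<close>
    define v where "v = inv_into (carrier B) f \<circ> w"
    have w_in: "w n \<in> f ` carrier B" for n
      using w by (auto simp: transport_simps)
    then have v: "range v \<subseteq> carrier B"
      by (auto simp: v_def intro: inv_into_into)
    have "w = f \<circ> v"
      using w_in by (simp add: v_def fun_eq_iff f_inv_into_f)
    moreover have "reval B v s = reval B v t"
      using assms st v by (auto simp: subvariety_def)
    ultimately show ?thesis
      using reval_transport[OF v] by simp
  qed
  then show ?thesis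
    using residuated_lattice_transport by (auto simp: subvariety_def)
qed

end

lemma rlat_hom_comp:
  assumes "g \<in> rlat_hom A B" "h \<in> rlat_hom B C"
  shows "h \<circ> g \<in> rlat_hom A C"
  using assms by (auto simp: rlat_hom_def hom_def Pi_iff)

text \<open>An infinite set is equinumerous with its square; this is how infinitude of the universe
  enters.\<close>

lemma ex_inj_square:
  assumes "infinite (UNIV :: 'u set)"
  shows "\<exists>f :: 'u \<times> 'u \<Rightarrow> 'u. inj f"
proof -
  obtain f :: "'u \<times> 'u \<Rightarrow> 'u" where "bij_betw f (UNIV \<times> UNIV) UNIV"
    using card_of_Times_same_infinite[OF assms] card_of_ordIso by blast
  then show ?thesis
    by (auto simp: bij_betw_def)
qed

theorem theorem5p3:
  fixes E :: "(rterm \<times> rterm) set" and A :: "'u rlat"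
  assumes "infinite (UNIV :: 'u set)"
    and "diamond_closed TYPE('u) E"
    and "absolute_retract E A"
  shows "\<exists>x. carrier A = {x}"
proof -
  have A: "A \<in> subvariety E"
    using assms(3) by (simp add: absolute_retract_def)
  then interpret residuated_lattice A
    by (simp add: subvariety_def)
  have D: "diamond A \<in> subvariety E"
    using A assms(2) by (simp add: diamond_closed_def)
  obtain f :: "'u \<times> 'u \<Rightarrow> 'u" where f: "inj f"
    using ex_inj_square[OF assms(1)] by blast
  \<comment> \<open>The residuated lattice laws of \<open>diamond A\<close> come from its membership
    in the subvariety, with no direct verification.\<close>
  interpret D: rlat_transport "diamond A" f
    using D inj_on_subset[OF f] by (simp add: subvariety_def rlat_transport_def rlat_transport_axioms_def)
  let ?i = "f \<circ> (\<lambda>a. (a, a))"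
  have "?i \<in> rlat_hom A (transport f (diamond A))"
    using diagonal_in_rlat_hom[OF residuated_lattice_axioms] D.transport_in_rlat_hom by (rule rlat_hom_comp)
  moreover have "inj_on ?i (carrier A)"
    by (rule inj_onI) (simp add: inj_eq[OF f])
  ultimately obtain r where r: "r \<in> rlat_hom (transport f (diamond A)) A"
    and retract: "\<And>a. a \<in> carrier A \<Longrightarrow> r (?i a) = a"
    using assms(3) D.transport_in_subvariety[OF D] unfolding absolute_retract_def by blast
  have "\<zero>\<^bsub>A\<^esub> = \<one>\<^bsub>A\<^esub>"
  proof (rule zero_eq_one_if_diamond_retract[OF residuated_lattice_axioms])
    \<comment> \<open>Precomposing with \<open>f\<close> turns the retraction of \<open>?i\<close>
      into one of the plain diagonal.\<close>
    show "r \<circ> f \<in> rlat_hom (diamond A) A"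
      using D.transport_in_rlat_hom r by (rule rlat_hom_comp)
  qed (use retract in simp)
  then show ?thesis
    using carrier_eq_singleton_if_zero_eq_one by blast
qed

end
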